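(* Let $R$ be a commutative ring with $1\neq0$ and let $P$ be a prime ideal of $R$. Then $P$ is strongly prime if and only if $R\setminus P$ is a strongly multiplicative set of $R$.
   Context: A prime ideal $P$ is strongly prime if for every family of ideals $(I_\lambda)_{\lambda\in\Lambda}$ of $R$ with $\bigcap_{\lambda\in\Lambda}I_\lambda\subseteq P$ one has $I_\mu\subseteq P$ for some $\mu\in\Lambda$. A multiplicative set $S$ of $R$ is a subset with $0\notin S$, $1\in S$, and $st\in S$ for all $s,t\in S$. It is strongly multiplicative if $\bigl(\bigcap_{i\in\Delta}s_iR\bigr)\cap S\neq\varnothing$ for every family $(s_i)_{i\in\Delta}$ of elements of $S$. *)

theory Defs
  imports "HOL-Algebra.Ideal"
begin

text \<open>
  Families of ideals or elements are rendered as sets of ideals or elements: hypothesis and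
  conclusion of both notions depend only on the range of the family, and an index type cannot be
  quantified inside a definition. The two lemmas at the end recover the formulations for families
  over an arbitrary index set. The factor \<^term>\<open>carrier R\<close> makes the intersection of the empty
  family the whole ring.
\<close>

definition strongly_prime :: "('a, 'b) ring_scheme \<Rightarrow> 'a set \<Rightarrow> bool" where
  "strongly_prime R P \<longleftrightarrow>
     primeideal P R \<and>
     (\<forall>\<I>. (\<forall>I\<in>\<I>. ideal I R) \<longrightarrow> carrier R \<inter> \<Inter>\<I> \<subseteq> P \<longrightarrow> (\<exists>I\<in>\<I>. I \<subseteq> P))"

definition multiplicative_set :: "('a, 'b) ring_scheme \<Rightarrow> 'a set \<Rightarrow> bool" where
  "multiplicative_set R S \<longleftrightarrow>
     S \<subseteq> carrier R \<and> \<zero>\<^bsub>R\<^esub> \<notin> S \<and> \<one>\<^bsub>R\<^esub> \<in> S \<and> (\<forall>s\<in>S. \<forall>t\<in>S. s \<otimes>\<^bsub>R\<^esub> t \<in> S)"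

definition strongly_multiplicative :: "('a, 'b) ring_scheme \<Rightarrow> 'a set \<Rightarrow> bool" where
  "strongly_multiplicative R S \<longleftrightarrow>
     multiplicative_set R S \<and>
     (\<forall>T. T \<subseteq> S \<longrightarrow> carrier R \<inter> (\<Inter>s\<in>T. PIdl\<^bsub>R\<^esub> s) \<inter> S \<noteq> {})"

lemma strongly_prime_family:
  assumes "strongly_prime R P" and "\<And>i. i \<in> \<Lambda> \<Longrightarrow> ideal (I i) R"
    and "carrier R \<inter> (\<Inter>i\<in>\<Lambda>. I i) \<subseteq> P"
  shows "\<exists>i\<in>\<Lambda>. I i \<subseteq> P"
proof -
  have "\<forall>J\<in>I ` \<Lambda>. ideal J R" using assms(2) by blast
  then have "\<exists>J\<in>I ` \<Lambda>. J \<subseteq> P"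
    using assms(1,3) unfolding strongly_prime_def by blast
  then show ?thesis by blast
qed

lemma strongly_multiplicative_family:
  assumes "strongly_multiplicative R S" and "\<And>i. i \<in> \<Delta> \<Longrightarrow> s i \<in> S"
  shows "carrier R \<inter> (\<Inter>i\<in>\<Delta>. PIdl\<^bsub>R\<^esub> (s i)) \<inter> S \<noteq> {}"
proof -
  have "s ` \<Delta> \<subseteq> S" using assms(2) by blast
  then have "carrier R \<inter> (\<Inter>t\<in>s ` \<Delta>. PIdl\<^bsub>R\<^esub> t) \<inter> S \<noteq> {}"
    using assms(1) unfolding strongly_multiplicative_def by blast
  then show ?thesis by simp
qed

end

theory Submission
  imports Defs
begin

text \<open>Since P is an ideal, an element s lies outside P exactly when sR is not contained in P.
  Thus strong multiplicativity of the complement is the contrapositive of strong primeness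
  restricted to principal ideals. Arbitrary ideals reduce to principal ones: if no I in the family
  lies in P, choose s in each I - P; then sR is contained in I, so a common multiple of the chosen
  elements outside P lies in every I. \<open>multiplicative_set_compl\<close> supplies the ordinary
  multiplicative part.\<close>

lemma (in primeideal) multiplicative_set_compl: "multiplicative_set R (carrier R - I)"
  unfolding multiplicative_set_def
proof (intro conjI ballI)
  show "\<one> \<in> carrier R - I"
    using I_notcarr one_imp_carrier by auto
  show "\<zero> \<notin> carrier R - I"
    by simp
  show "s \<otimes> t \<in> carrier R - I" if "s \<in> carrier R - I" "t \<in> carrier R - I" for s t
    using that I_prime[of s t] by auto
qed auto

theorem theorem3p1:
  fixes R :: "('a, 'b) ring_scheme" and P :: "'a set"
  assumes "cring R" and "\<one>\<^bsub>R\<^esub> \<noteq> \<zero>\<^bsub>R\<^esub>" and "primeideal P R"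
  shows "strongly_prime R P \<longleftrightarrow> strongly_multiplicative R (carrier R - P)"
proof
  interpret cring R by fact
  assume sp: "strongly_prime R P"
  have "carrier R \<inter> (\<Inter>s\<in>T. PIdl\<^bsub>R\<^esub> s) \<inter> (carrier R - P) \<noteq> {}" if T: "T \<subseteq> carrier R - P" for T
  proof
    assume "carrier R \<inter> (\<Inter>s\<in>T. PIdl\<^bsub>R\<^esub> s) \<inter> (carrier R - P) = {}"
    \<comment> \<open>Missing the complement means lying in \<open>P\<close>; strong primeness then
      forces one principal ideal, and with it its generator from \<open>T\<close>, into
      \<open>P\<close>.\<close>
    then have "carrier R \<inter> (\<Inter>s\<in>T. PIdl\<^bsub>R\<^esub> s) \<subseteq> P" by blast
    moreover have "ideal (PIdl\<^bsub>R\<^esub> s) R" if "s \<in> T" for s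
      using that T cgenideal_ideal[of s] by auto
    ultimately obtain s where "s \<in> T" "PIdl\<^bsub>R\<^esub> s \<subseteq> P"
      using strongly_prime_family[OF sp, of T "\<lambda>s. PIdl\<^bsub>R\<^esub> s"] by blast
    then show False using T cgenideal_self[of s] by auto
  qed
  then show "strongly_multiplicative R (carrier R - P)"
    using primeideal.multiplicative_set_compl[OF assms(3)]
    unfolding strongly_multiplicative_def by blast
next
  interpret cring R by fact
  assume sm: "strongly_multiplicative R (carrier R - P)"
  have "\<exists>I\<in>\<I>. I \<subseteq> P"
    if ideals: "\<forall>I\<in>\<I>. ideal I R" and sub: "carrier R \<inter> \<Inter>\<I> \<subseteq> P" for \<I>
  proof (rule ccontr)
    assume "\<not> (\<exists>I\<in>\<I>. I \<subseteq> P)"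
    \<comment> \<open>Each ideal contributes one witness of its not lying in \<open>P\<close>; the
      ideals themselves index the resulting family.\<close>
    then have "\<forall>I\<in>\<I>. \<exists>s. s \<in> I - P" by blast
    then obtain s where s: "\<And>I. I \<in> \<I> \<Longrightarrow> s I \<in> I - P" by metis
    have "s I \<in> carrier R - P" if "I \<in> \<I>" for I
      using that s[OF that] ideal.Icarr[of I R "s I"] ideals by auto
    then obtain x where x: "x \<in> carrier R - P" "\<And>I. I \<in> \<I> \<Longrightarrow> x \<in> PIdl\<^bsub>R\<^esub> (s I)"
      using strongly_multiplicative_family[OF sm, of \<I> s] by blast
    have "PIdl\<^bsub>R\<^esub> (s I) \<subseteq> I" if "I \<in> \<I>" for I
      using s[OF that] ideals that cgenideal_minimal[of I "s I"] by auto
    \<comment> \<open>\<open>x\<close> lies in every member of \<open>\<I>\<close>, so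
      \<open>sub\<close> puts it in \<open>P\<close>; that \<open>x\<close> is in
      \<open>carrier R\<close> covers the case of empty \<open>\<I>\<close>.\<close>
    then show False using x sub by blast
  qed
  then show "strongly_prime R P"
    using assms(3) unfolding strongly_prime_def by blast
qed

end
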